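(* Let $L$ be a vector space, $w_1,w_2\in\mathrm{Hom}(\wedge^2L,L)$ and $\delta_1,\delta_2\in\mathrm{Hom}(L,L)$. Then $(L,w_1,w_2,\delta_1,\delta_2)$ is a compatible LieDer pair if and only if $\big((w_1,\delta_1),(w_2,\delta_2)\big)$ is a Maurer-Cartan element of the bidifferential graded Lie algebra $(DC^{\star}(L,L),\{\cdot,\cdot\},0,0)$ with both differentials equal to zero.
   Context: All vector spaces are over a field $\mathbb{K}$ of characteristic $0$. A LieDer pair $(L,[\cdot,\cdot],\delta)$ is a Lie algebra with a linear map $\delta:L\to L$ such that $\delta[x,y]=[\delta x,y]+[x,\delta y]$. A compatible LieDer pair $(L,[\cdot,\cdot]_1,[\cdot,\cdot]_2,\delta_1,\delta_2)$ consists of two LieDer pairs $(L,[\cdot,\cdot]_1,\delta_1)$, $(L,[\cdot,\cdot]_2,\delta_2)$ on the same vector space such that for all $x,y,z\in L$ (with $\circlearrowleft_{x,y,z}$ the sum over cyclic permutations of $x,y,z$): (1) $\circlearrowleft_{x,y,z}[x,[y,z]_1]_2+\circlearrowleft_{x,y,z}[x,[y,z]_2]_1=0$; (2) $\delta_1[x,y]_2+\delta_2[x,y]_1=[\delta_1x,y]_2+[x,\delta_1y]_2+[\delta_2x,y]_1+[x,\delta_2y]_1$. A map $w\in\mathrm{Hom}(\wedge^2L,L)$ is viewed as the skew-symmetric bracket $[x,y]=w(x,y)$. The Nijenhuis-Richardson bracket of $f\in\mathrm{Hom}(\wedge^{p+1}L,L)$ and $g\in\mathrm{Hom}(\wedge^{q+1}L,L)$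 is $[f,g]_{\mathrm{NR}}=f\circ g-(-1)^{pq}g\circ f$, where $(f\circ g)(x_1,\ldots,x_{p+q+1})=\sum_{\sigma}\mathrm{sgn}(\sigma)f(g(x_{\sigma(1)},\ldots,x_{\sigma(q+1)}),x_{\sigma(q+2)},\ldots,x_{\sigma(p+q+1)})$, the sum being over $(q+1,p)$-shuffles. The graded space $DC^{\star}(L,L)=\bigoplus_{n\ge0}DC^n(L,L)$, $DC^n(L,L)=\mathrm{Hom}(\wedge^{n+1}L,L)\times\mathrm{Hom}(\wedge^nL,L)$ (in degree $n$), is a graded Lie algebra under $\{(f_{m+1},g_m),(f_{n+1},g_n)\}=\big([f_{m+1},f_{n+1}]_{\mathrm{NR}},(-1)^m[f_{m+1},g_n]_{\mathrm{NR}}-(-1)^{n(m+1)}[f_{n+1},g_m]_{\mathrm{NR}}\big)$. A bidifferential graded Lie algebra is a graded Lie algebra with two differentials $\partial_1,\partial_2$, each making it a differential graded Lie algebra, such that $\partial_1\partial_2+\partial_2\partial_1=0$. An element $P$ of degree $1$ of a differential graded Lie algebra is Maurer-Cartan if $\partial P+\frac12[P,P]=0$. When both differentials are zero, a pair $(P_1,P_2)$ of degree-$1$ elements is called a Maurer-Cartan element of the bidifferential graded Lie algebra if $P_1$ and $P_2$ are each Maurer-Cartan (i.e. $\{P_1,P_1\}=\{P_2,P_2\}=0$) and $\{P_1,P_2\}=0$. *)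

theory Defs
  imports
    Complex_Main
    "HOL-Library.Function_Algebras"
    "HOL-Library.Product_Plus"
    "HOL-Combinatorics.Permutations"
begin

section \<open>Compatible LieDer pairs\<close>

locale lie_algebra = vector_space scale
  for scale :: "'k::field \<Rightarrow> 'v::ab_group_add \<Rightarrow> 'v" +
  fixes bracket :: "'v \<Rightarrow> 'v \<Rightarrow> 'v"
  assumes bracket_linear_left: "Vector_Spaces.linear scale scale (\<lambda>x. bracket x y)"
    and bracket_linear_right: "Vector_Spaces.linear scale scale (\<lambda>y. bracket x y)"
    and bracket_alternating: "bracket x x = 0"
    and jacobi: "bracket x (bracket y z) + bracket y (bracket z x) + bracket z (bracket x y) = 0"

locale lieder_pair = lie_algebra scale bracket
  for scale :: "'k::field \<Rightarrow> 'v::ab_group_add \<Rightarrow> 'v"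
    and bracket :: "'v \<Rightarrow> 'v \<Rightarrow> 'v" +
  fixes \<delta> :: "'v \<Rightarrow> 'v"
  assumes derivation_linear: "Vector_Spaces.linear scale scale \<delta>"
    and derivation: "\<delta> (bracket x y) = bracket (\<delta> x) y + bracket x (\<delta> y)"

locale compatible_lieder_pair =
  P1: lieder_pair scale br1 \<delta>1 + P2: lieder_pair scale br2 \<delta>2
  for scale :: "'k::field \<Rightarrow> 'v::ab_group_add \<Rightarrow> 'v"
    and br1 br2 :: "'v \<Rightarrow> 'v \<Rightarrow> 'v"
    and \<delta>1 \<delta>2 :: "'v \<Rightarrow> 'v" +
  assumes compatible_brackets:
      "(br2 x (br1 y z) + br2 y (br1 z x) + br2 z (br1 x y))
       + (br1 x (br2 y z) + br1 y (br2 z x) + br1 z (br2 x y)) = 0"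
    and compatible_derivations:
      "\<delta>1 (br2 x y) + \<delta>2 (br1 x y)
       = br2 (\<delta>1 x) y + br2 x (\<delta>1 y) + br1 (\<delta>2 x) y + br1 x (\<delta>2 y)"

section \<open>Alternating maps and the Nijenhuis--Richardson bracket\<close>

text \<open>
  Hom of the n-th exterior power of L into L, as alternating n-linear maps. The n arguments are
  passed as a list; maps vanish on lists of any other length, so that equality of maps is equality
  of HOL functions. For n = 0 this is a copy of L.
\<close>

definition alt_hom :: "('k::field \<Rightarrow> 'v::ab_group_add \<Rightarrow> 'v) \<Rightarrow> nat \<Rightarrow> ('v list \<Rightarrow> 'v) set" where
  "alt_hom scale n = {f.
     (\<forall>xs. length xs \<noteq> n \<longrightarrow> f xs = 0) \<and>
     (\<forall>xs i. length xs = n \<longrightarrow> i < n \<longrightarrow> Vector_Spaces.linear scale scale (\<lambda>x. f (xs[i := x]))) \<and>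
     (\<forall>xs i j. length xs = n \<longrightarrow> i < j \<longrightarrow> j < n \<longrightarrow> xs ! i = xs ! j \<longrightarrow> f xs = 0)}"

text \<open>The identification of Hom(L, L) with \<open>alt_hom scale 1\<close>.\<close>

definition hom1 :: "('v \<Rightarrow> 'v::zero) \<Rightarrow> 'v list \<Rightarrow> 'v" where
  "hom1 \<delta> xs = (if length xs = 1 then \<delta> (hd xs) else 0)"

definition shuffle_perms :: "nat \<Rightarrow> nat \<Rightarrow> (nat \<Rightarrow> nat) set" where
  "shuffle_perms b c = {\<sigma>. \<sigma> permutes {..<b + c} \<and>
     strict_mono_on {..<b} \<sigma> \<and> strict_mono_on {b..<b + c} \<sigma>}"

text \<open>
  \<open>nr_circ scale a b f g\<close> and \<open>nr_bracket scale a b f g\<close> are the composition and the bracket of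
  a map f of arity a and a map g of arity b; in terms of the degrees p, q of the
  Nijenhuis--Richardson bracket, a = p + 1 and b = q + 1. Degree -1 (arity 0) is
  allowed; if f has arity 0, there are no (q + 1, p)-shuffles and the composition is 0.
\<close>

definition nr_circ :: "('k::field \<Rightarrow> 'v::ab_group_add \<Rightarrow> 'v) \<Rightarrow> nat \<Rightarrow> nat
    \<Rightarrow> ('v list \<Rightarrow> 'v) \<Rightarrow> ('v list \<Rightarrow> 'v) \<Rightarrow> 'v list \<Rightarrow> 'v" where
  "nr_circ scale a b f g xs =
     (if a \<ge> 1 \<and> length xs = b + (a - 1)
      then \<Sum>\<sigma>\<in>shuffle_perms b (a - 1). scale (of_int (sign \<sigma>))
             (f (g (map (\<lambda>i. xs ! \<sigma> i) [0..<b]) # map (\<lambda>i. xs ! \<sigma> i) [b..<b + (a - 1)]))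
      else 0)"

definition nr_bracket :: "('k::field \<Rightarrow> 'v::ab_group_add \<Rightarrow> 'v) \<Rightarrow> nat \<Rightarrow> nat
    \<Rightarrow> ('v list \<Rightarrow> 'v) \<Rightarrow> ('v list \<Rightarrow> 'v) \<Rightarrow> 'v list \<Rightarrow> 'v" where
  "nr_bracket scale a b f g xs =
     nr_circ scale a b f g xs
     - scale ((-1) powi ((int a - 1) * (int b - 1))) (nr_circ scale b a g f xs)"

section \<open>The graded Lie algebra of LieDer pairs\<close>

text \<open>
  A graded vector space is given by its homogeneous components \<open>V n\<close>, as subsets of one ambient
  type; the bracket \<open>br m n\<close> and a differential \<open>d n\<close> carry the degrees of their arguments.
\<close>

type_synonym 'v dc = "('v list \<Rightarrow> 'v) \<times> ('v list \<Rightarrow> 'v)"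

definition dc_space :: "('k::field \<Rightarrow> 'v::ab_group_add \<Rightarrow> 'v) \<Rightarrow> nat \<Rightarrow> 'v dc set" where
  "dc_space scale n = alt_hom scale (n + 1) \<times> alt_hom scale n"

definition dc_scale :: "('k::field \<Rightarrow> 'v::ab_group_add \<Rightarrow> 'v) \<Rightarrow> 'k \<Rightarrow> 'v dc \<Rightarrow> 'v dc" where
  "dc_scale scale c P = ((\<lambda>xs. scale c (fst P xs)), (\<lambda>xs. scale c (snd P xs)))"

definition dc_bracket :: "('k::field \<Rightarrow> 'v::ab_group_add \<Rightarrow> 'v) \<Rightarrow> nat \<Rightarrow> nat
    \<Rightarrow> 'v dc \<Rightarrow> 'v dc \<Rightarrow> 'v dc" where
  "dc_bracket scale m n P Q =
     (nr_bracket scale (m + 1) (n + 1) (fst P) (fst Q),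
      (\<lambda>xs. scale ((-1) ^ m) (nr_bracket scale (m + 1) n (fst P) (snd Q) xs)
            - scale ((-1) ^ (n * (m + 1))) (nr_bracket scale (n + 1) m (fst Q) (snd P) xs)))"

definition maurer_cartan :: "('k::field \<Rightarrow> 'a::ab_group_add \<Rightarrow> 'a) \<Rightarrow> (nat \<Rightarrow> 'a set)
    \<Rightarrow> (nat \<Rightarrow> nat \<Rightarrow> 'a \<Rightarrow> 'a \<Rightarrow> 'a) \<Rightarrow> (nat \<Rightarrow> 'a \<Rightarrow> 'a) \<Rightarrow> 'a \<Rightarrow> bool" where
  "maurer_cartan scale V br d P \<longleftrightarrow>
     P \<in> V 1 \<and> d 1 P + scale (1/2) (br 1 1 P P) = 0"

text \<open>
  For zero differentials this says that P1 and P2 have degree 1 and that the brackets of P1 with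
  P1, of P2 with P2 and of P1 with P2 vanish.
\<close>

definition bidifferential_maurer_cartan :: "('k::field \<Rightarrow> 'a::ab_group_add \<Rightarrow> 'a)
    \<Rightarrow> (nat \<Rightarrow> 'a set) \<Rightarrow> (nat \<Rightarrow> nat \<Rightarrow> 'a \<Rightarrow> 'a \<Rightarrow> 'a)
    \<Rightarrow> (nat \<Rightarrow> 'a \<Rightarrow> 'a) \<Rightarrow> (nat \<Rightarrow> 'a \<Rightarrow> 'a) \<Rightarrow> 'a \<times> 'a \<Rightarrow> bool" where
  "bidifferential_maurer_cartan scale V br d1 d2 = (\<lambda>(P1, P2).
     maurer_cartan scale V br d1 P1 \<and> maurer_cartan scale V br d2 P2 \<and>
     d1 1 P2 + d2 1 P1 + br 1 1 P1 P2 = 0)"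

end

theory Submission
  imports Defs
begin

text \<open>
  On the shuffles that occur in degree 1, \<open>{(w, \<delta>), (w', \<delta>')}\<close> has as first component minus the
  sum of the two mixed Jacobiators of \<open>w\<close> and \<open>w'\<close>, and as second component the sum of the defects
  of \<open>\<delta>'\<close> being a derivation of \<open>w\<close> and of \<open>\<delta>\<close> being a derivation of \<open>w'\<close>. The three Maurer--Cartan
  equations are therefore the defining identities of a compatible LieDer pair, those for
  \<open>P1 = P2\<close> doubled, which is harmless in characteristic 0.
\<close>

section \<open>Shuffles and signs in low arity\<close>

lemma lessThan_3: "{..<3::nat} = {0, 1, 2}"
  by auto

lemma lessThan_2: "{..<2::nat} = {0, 1}"
  by auto

lemma shuffle_perms_2_0: "shuffle_perms 2 0 = {id}"
proof (intro equalityI subsetI)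
  fix \<sigma> assume "\<sigma> \<in> shuffle_perms 2 0"
  then have p: "\<sigma> permutes {..<2}" and m: "strict_mono_on {..<2} \<sigma>"
    by (auto simp: shuffle_perms_def)
  have "\<sigma> 0 < \<sigma> 1"
    using strict_mono_onD[OF m, of 0 1] by simp
  moreover have "\<sigma> 1 < 2"
    using permutes_in_image[OF p, of 1] by simp
  ultimately have v: "\<sigma> 0 = 0" "\<sigma> 1 = 1"
    by linarith+
  have "\<sigma> i = id i" for i
  proof (cases "i \<in> {..<2}")
    case True
    then show ?thesis using v by (auto simp: lessThan_2)
  qed (simp add: permutes_not_in[OF p])
  then show "\<sigma> \<in> {id}"
    by auto
qed (auto simp: shuffle_perms_def permutes_id intro: strict_mono_onI)

text \<open>Monotonicity on a one-element block is vacuous, so every permutation of two points is a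
  (1,1)-shuffle.\<close>

lemma shuffle_perms_1_1: "shuffle_perms 1 1 = {id, transpose 0 1}"
proof (intro equalityI subsetI)
  fix \<sigma> assume "\<sigma> \<in> shuffle_perms 1 1"
  then have "\<sigma> permutes {0, 1}"
    by (auto simp: shuffle_perms_def lessThan_2 numeral_2_eq_2[symmetric])
  then show "\<sigma> \<in> {id, transpose 0 1}"
    by (simp add: permutes_doubleton_iff)
next
  fix \<sigma> :: "nat \<Rightarrow> nat" assume "\<sigma> \<in> {id, transpose 0 1}"
  moreover have "transpose 0 (1::nat) permutes {..<2}"
    by (rule permutes_swap_id) auto
  ultimately show "\<sigma> \<in> shuffle_perms 1 1"
    by (auto simp: shuffle_perms_def permutes_id numeral_2_eq_2 intro!: strict_mono_onI)
qed

text \<open>A (2,1)-shuffle is determined by the value at \<open>2\<close>, since the two others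
  follow in increasing order. Writing the three shuffles as products of transpositions makes their
  signs computable.\<close>

lemma shuffle_perms_2_1:
  "shuffle_perms 2 1 = {id, transpose 1 2, transpose 0 1 \<circ> transpose 1 2}"
proof (intro equalityI subsetI)
  fix \<sigma> assume "\<sigma> \<in> shuffle_perms 2 1"
  then have p: "\<sigma> permutes {..<3}" and m: "strict_mono_on {..<2} \<sigma>"
    by (auto simp: shuffle_perms_def)
  have less: "\<sigma> 0 < \<sigma> 1"
    using strict_mono_onD[OF m, of 0 1] by simp
  have bounds: "\<sigma> 0 < 3" "\<sigma> 1 < 3" "\<sigma> 2 < 3"
    using permutes_in_image[OF p, of 0] permutes_in_image[OF p, of 1]
      permutes_in_image[OF p, of 2] by simp_all
  have neq: "\<sigma> 2 \<noteq> \<sigma> 0" "\<sigma> 2 \<noteq> \<sigma> 1"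
    using permutes_inj[OF p] by (auto simp: inj_eq)
  \<comment> \<open>Both permutations fix every point outside \<open>{..<3}\<close>, so agreement at
    \<open>0\<close>, \<open>1\<close>, \<open>2\<close> is enough.\<close>
  have eqI: "\<sigma> = \<tau>" if "\<tau> permutes {..<3}" "\<sigma> 0 = \<tau> 0" "\<sigma> 1 = \<tau> 1" "\<sigma> 2 = \<tau> 2" for \<tau>
  proof
    fix i show "\<sigma> i = \<tau> i"
    proof (cases "i \<in> {..<3}")
      case True
      then show ?thesis using that by (auto simp: lessThan_3)
    qed (simp add: permutes_not_in[OF p] permutes_not_in[OF that(1)])
  qed
  have t: "transpose 1 (2::nat) permutes {..<3}" "transpose 0 (1::nat) permutes {..<3}"
    by (auto intro!: permutes_swap_id)
  consider "\<sigma> 0 = 0" "\<sigma> 1 = 1" "\<sigma> 2 = 2" | "\<sigma> 0 = 0" "\<sigma> 1 = 2" "\<sigma> 2 = 1"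
    | "\<sigma> 0 = 1" "\<sigma> 1 = 2" "\<sigma> 2 = 0"
    using less bounds neq by linarith
  then show "\<sigma> \<in> {id, transpose 1 2, transpose 0 1 \<circ> transpose 1 2}"
  proof cases
    case 1
    then have "\<sigma> = id" by (intro eqI) (auto simp: permutes_id)
    then show ?thesis by simp
  next
    case 2
    then have "\<sigma> = transpose 1 2" using t by (intro eqI) (auto simp: transpose_def)
    then show ?thesis by simp
  next
    case 3
    then have "\<sigma> = transpose 0 1 \<circ> transpose 1 2"
      using t by (intro eqI permutes_compose) (auto simp: transpose_def)
    then show ?thesis by simp
  qed
next
  fix \<sigma> :: "nat \<Rightarrow> nat" assume \<sigma>: "\<sigma> \<in> {id, transpose 1 2, transpose 0 1 \<circ> transpose 1 2}"
  have t: "transpose 1 (2::nat) permutes {..<3}" "transpose 0 (1::nat) permutes {..<3}"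
    by (auto intro!: permutes_swap_id)
  have "\<sigma> permutes {..<3}"
    using \<sigma> t by (auto intro!: permutes_compose permutes_id)
  moreover have "strict_mono_on {..<2} \<sigma>"
    using \<sigma> by (intro strict_mono_onI) (auto simp: lessThan_2 transpose_def)
  moreover have "strict_mono_on {2..<3} \<sigma>"
    by (intro strict_mono_onI) auto
  ultimately show "\<sigma> \<in> shuffle_perms 2 1"
    by (simp add: shuffle_perms_def)
qed

lemma sign_transpose_comp_transpose:
  "sign (transpose 0 1 \<circ> transpose 1 (2::nat)) = 1"
  by (subst sign_compose) (auto simp: sign_swap_id permutation_swap_id)

section \<open>Alternating maps of arity 2 and 1\<close>

lemma alt_hom_2_bilinear:
  assumes "f \<in> alt_hom scale 2"
  shows "Vector_Spaces.linear scale scale (\<lambda>x. f [x, y])"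
    and "Vector_Spaces.linear scale scale (\<lambda>x. f [y, x])"
proof -
  have "\<forall>xs i. length xs = 2 \<longrightarrow> i < 2 \<longrightarrow> Vector_Spaces.linear scale scale (\<lambda>z. f (xs[i := z]))"
    using assms by (simp add: alt_hom_def)
  \<comment> \<open>One entry of \<open>[y, y]\<close> is a placeholder: the update overwrites it,
    and the other entry is the fixed argument.\<close>
  from this[rule_format, of "[y, y]" 0] this[rule_format, of "[y, y]" 1] show "Vector_Spaces.linear scale scale (\<lambda>x. f [x, y])"
    "Vector_Spaces.linear scale scale (\<lambda>x. f [y, x])" by simp_all
qed

lemma alt_hom_2_alternating:
  assumes "f \<in> alt_hom scale 2"
  shows "f [x, x] = 0"
proof -
  have "\<forall>xs i j. length xs = 2 \<longrightarrow> i < j \<longrightarrow> j < 2 \<longrightarrow> xs ! i = xs ! j \<longrightarrow> f xs = 0"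
    using assms by (simp add: alt_hom_def)
  from this[rule_format, of "[x, x]" 0 1] show ?thesis
    by simp
qed

text \<open>Polarization: expand \<open>f [x + y, x + y] = 0\<close>, where the two diagonal terms
  vanish.\<close>

lemma alt_hom_2_skew:
  assumes "f \<in> alt_hom scale 2"
  shows "f [x, y] = - f [y, x]"
proof -
  interpret l: Vector_Spaces.linear scale scale "\<lambda>z. f [z, x + y]"
    by (rule alt_hom_2_bilinear[OF assms])
  interpret rx: Vector_Spaces.linear scale scale "\<lambda>z. f [x, z]"
    by (rule alt_hom_2_bilinear[OF assms])
  interpret ry: Vector_Spaces.linear scale scale "\<lambda>z. f [y, z]"
    by (rule alt_hom_2_bilinear[OF assms])
  have "0 = f [x + y, x + y]"
    by (simp only: alt_hom_2_alternating[OF assms])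
  also have "\<dots> = f [x, y] + f [y, x]"
    by (simp only: l.add rx.add ry.add) (simp add: alt_hom_2_alternating[OF assms])
  finally show ?thesis by (metis eq_neg_iff_add_eq_0)
qed

text \<open>In arity 1 the alternating condition is vacuous, and updating the only entry of a list
  leaves \<open>\<delta>\<close> itself.\<close>

lemma hom1_mem_alt_hom:
  assumes "Vector_Spaces.linear scale scale \<delta>"
  shows "hom1 \<delta> \<in> alt_hom scale 1"
proof -
  have "(\<lambda>x. hom1 \<delta> (xs[i := x])) = \<delta>" if "length xs = 1" "i < 1" for xs i
    using that by (cases xs) (auto simp: hom1_def)
  then show ?thesis
    using assms by (auto simp: alt_hom_def) (simp add: hom1_def)
qed

section \<open>Evaluation of the brackets in degree 1\<close>

context vector_space
begin

text \<open>The three shuffles have signs +, -, +. Skew-symmetry then moves each inner bracket into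
  the second slot of \<open>f\<close>, which produces the cyclic sum with a global minus
  sign.\<close>

lemma nr_circ_2_2:
  assumes f: "f \<in> alt_hom scale 2" and g: "g \<in> alt_hom scale 2"
  shows "nr_circ scale 2 2 f g [x, y, z]
    = - (f [x, g [y, z]] + f [y, g [z, x]] + f [z, g [x, y]])"
proof -
  \<comment> \<open>The shuffles must be pairwise different for the sum over the explicit set to
    split into three summands.\<close>
  have distinct: "transpose 1 (2::nat) \<noteq> id"
    by (auto simp: transpose_def dest!: fun_cong[of _ _ 1])
  have distinct': "transpose 0 1 \<circ> transpose 1 (2::nat) \<noteq> id"
      "transpose 0 1 \<circ> transpose 1 (2::nat) \<noteq> transpose 1 2"
    by (auto simp: transpose_def dest!: fun_cong[of _ _ 0])
  have "nr_circ scale 2 2 f g [x, y, z]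
    = (\<Sum>\<sigma>\<in>{id, transpose 1 2, transpose 0 1 \<circ> transpose 1 2}. scale (of_int (sign \<sigma>))
        (f [g [[x, y, z] ! \<sigma> 0, [x, y, z] ! \<sigma> 1], [x, y, z] ! \<sigma> 2]))"
    unfolding shuffle_perms_2_1[symmetric] by (simp add: nr_circ_def upt_rec numeral_2_eq_2)
  also have "\<dots> = f [g [x, y], z] - f [g [x, z], y] + f [g [y, z], x]"
    using distinct distinct' by (simp add: sign_transpose_comp_transpose[simplified] sign_swap_id
        transpose_def)
  also have "f [g [x, y], z] = - f [z, g [x, y]]"
    by (rule alt_hom_2_skew[OF f])
  \<comment> \<open>Swapping the arguments of \<open>f\<close> and those of \<open>g\<close> gives
    two signs, which cancel once linearity pulls the inner one out.\<close>
  also have "f [g [x, z], y] = f [y, g [z, x]]"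
  proof -
    interpret Vector_Spaces.linear scale scale "\<lambda>v. f [y, v]"
      by (rule alt_hom_2_bilinear[OF f])
    show ?thesis
      by (subst alt_hom_2_skew[OF f], subst alt_hom_2_skew[OF g]) (simp only: neg minus_minus)
  qed
  also have "f [g [y, z], x] = - f [x, g [y, z]]"
    by (rule alt_hom_2_skew[OF f])
  finally show ?thesis by simp
qed

lemma nr_bracket_2_2_eq_0_iff:
  assumes f: "f \<in> alt_hom scale 2" and g: "g \<in> alt_hom scale 2"
  shows "nr_bracket scale 2 2 f g = 0 \<longleftrightarrow>
    (\<forall>x y z. (g [x, f [y, z]] + g [y, f [z, x]] + g [z, f [x, y]])
      + (f [x, g [y, z]] + f [y, g [z, x]] + f [z, g [x, y]]) = 0)"
    (is "?l \<longleftrightarrow> (\<forall>x y z. ?J x y z = 0)")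
proof -
  \<comment> \<open>Both maps have degree 1, so the sign \<open>(-1) powi 1\<close> turns the
    difference of the two compositions into their sum.\<close>
  have eval: "nr_bracket scale 2 2 f g [x, y, z] = - ?J x y z" for x y z
    by (simp add: nr_bracket_def nr_circ_2_2[OF f g] nr_circ_2_2[OF g f])
  \<comment> \<open>Both compositions take the default value \<open>0\<close> off length 3, so
    equality of functions only has to be tested on triples.\<close>
  have zero: "nr_bracket scale 2 2 f g xs = 0" if "length xs \<noteq> 3" for xs
    using that by (simp add: nr_bracket_def nr_circ_def)
  have "?l \<longleftrightarrow> (\<forall>x y z. nr_bracket scale 2 2 f g [x, y, z] = 0)"
  proof
    assume R: "\<forall>x y z. nr_bracket scale 2 2 f g [x, y, z] = 0"
    show ?l
    proof
      fix xs show "nr_bracket scale 2 2 f g xs = 0 xs"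
      proof (cases "length xs = 3")
        case True
        then obtain x y z where "xs = [x, y, z]"
          by (auto simp: numeral_3_eq_3 length_Suc_conv)
        then show ?thesis using R by simp
      qed (simp add: zero)
    qed
  qed simp
  then show ?thesis by (simp only: eval neg_equal_0_iff_equal)
qed

text \<open>The two shuffles for \<open>f\<close> after \<open>\<delta>\<close> give the two terms
  of the Leibniz rule, up to skew-symmetry. The single shuffle for \<open>\<delta>\<close> after
  \<open>f\<close> gives the last term, which is subtracted because \<open>\<delta>\<close> has
  degree 0.\<close>

lemma nr_bracket_2_1:
  assumes f: "f \<in> alt_hom scale 2"
  shows "nr_bracket scale 2 1 f (hom1 \<delta>) [x, y]
    = f [\<delta> x, y] + f [x, \<delta> y] - \<delta> (f [x, y])"
proof -
  have distinct: "transpose 0 (1::nat) \<noteq> id"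
    by (auto simp: fun_eq_iff transpose_def)
  have "nr_circ scale 2 1 f (hom1 \<delta>) [x, y]
    = (\<Sum>\<sigma>\<in>{id, transpose 0 1}. scale (of_int (sign \<sigma>))
        (f [\<delta> ([x, y] ! \<sigma> 0), [x, y] ! \<sigma> 1]))"
    unfolding shuffle_perms_1_1[symmetric] by (simp add: nr_circ_def upt_rec hom1_def)
  also have "\<dots> = f [\<delta> x, y] - f [\<delta> y, x]"
    using distinct by (simp add: sign_swap_id)
  also have "f [\<delta> y, x] = - f [x, \<delta> y]"
    by (rule alt_hom_2_skew[OF f])
  finally have "nr_circ scale 2 1 f (hom1 \<delta>) [x, y] = f [\<delta> x, y] + f [x, \<delta> y]"
    by simp
  moreover have "nr_circ scale 1 2 (hom1 \<delta>) f [x, y] = \<delta> (f [x, y])"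
    by (simp add: nr_circ_def shuffle_perms_2_0 upt_rec hom1_def)
  ultimately show ?thesis by (simp add: nr_bracket_def)
qed

lemma nr_bracket_2_1_eq_0: "length xs \<noteq> 2 \<Longrightarrow> nr_bracket scale 2 1 f g xs = 0"
  by (auto simp: nr_bracket_def nr_circ_def)

lemma dc_bracket_1_1_eq_0_iff:
  assumes f: "f \<in> alt_hom scale 2" and g: "g \<in> alt_hom scale 2"
  shows "dc_bracket scale 1 1 (f, hom1 \<delta>) (g, hom1 \<epsilon>) = 0 \<longleftrightarrow>
    (\<forall>x y z. (g [x, f [y, z]] + g [y, f [z, x]] + g [z, f [x, y]])
      + (f [x, g [y, z]] + f [y, g [z, x]] + f [z, g [x, y]]) = 0) \<and>
    (\<forall>x y. \<delta> (g [x, y]) + \<epsilon> (f [x, y])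
      = g [\<delta> x, y] + g [x, \<delta> y] + f [\<epsilon> x, y] + f [x, \<epsilon> y])"
proof -
  \<comment> \<open>The second component of the bracket for \<open>m = n = 1\<close>: the signs are
    \<open>(-1) ^ 1\<close> and \<open>(-1) ^ 2\<close>, so both terms enter with a minus.\<close>
  let ?s = "\<lambda>xs. - nr_bracket scale 2 1 f (hom1 \<epsilon>) xs - nr_bracket scale 2 1 g (hom1 \<delta>) xs"
  have "?s = 0 \<longleftrightarrow> (\<forall>x y. ?s [x, y] = 0)"
  proof
    assume R: "\<forall>x y. ?s [x, y] = 0"
    show "?s = 0"
    proof
      fix xs show "?s xs = 0 xs"
      proof (cases "length xs = 2")
        case True
        then obtain x y where "xs = [x, y]"
          by (auto simp: numeral_2_eq_2 length_Suc_conv)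
        then show ?thesis using R by simp
      qed (simp add: nr_bracket_2_1_eq_0 del: One_nat_def)
    qed
  qed (simp add: fun_eq_iff)
  also have "\<dots> \<longleftrightarrow> (\<forall>x y. \<delta> (g [x, y]) + \<epsilon> (f [x, y])
      = g [\<delta> x, y] + g [x, \<delta> y] + f [\<epsilon> x, y] + f [x, \<epsilon> y])"
    unfolding nr_bracket_2_1[OF f] nr_bracket_2_1[OF g]
    by (intro all_cong1) (auto simp: algebra_simps eq_neg_iff_add_eq_0)
  finally have snd: "?s = 0 \<longleftrightarrow> \<dots>" .
  have "dc_bracket scale 1 1 (f, hom1 \<delta>) (g, hom1 \<epsilon>) = (nr_bracket scale 2 2 f g, ?s)"
    by (simp add: dc_bracket_def numeral_2_eq_2)
  then show ?thesis
    by (simp add: zero_prod_def nr_bracket_2_2_eq_0_iff[OF f g] snd del: One_nat_def)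
qed

end

section \<open>Maurer-Cartan elements and LieDer pairs\<close>

lemma (in vector_space) scale_two: "scale 2 x = x + x"
  by (metis one_add_one scale_left_distrib scale_one)

text \<open>\<open>x + x\<close> is \<open>x\<close> scaled by \<open>2\<close>, which is nonzero in
  characteristic 0. This removes the doubling that arises when an element is bracketed with
  itself.\<close>

lemma double_eq_0_iff:
  fixes scale :: "'k::field_char_0 \<Rightarrow> 'v::ab_group_add \<Rightarrow> 'v" and x :: 'v
  assumes "vector_space scale"
  shows "x + x = 0 \<longleftrightarrow> x = 0"
proof -
  interpret vector_space scale by fact
  show ?thesis
    using scale_eq_0_iff[of 2 x] by (simp add: scale_two)
qed

lemma maurer_cartan_iff_lieder_pair:
  fixes scale :: "'k::field_char_0 \<Rightarrow> 'v::ab_group_add \<Rightarrow> 'v"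
  assumes vs: "vector_space scale"
    and w: "w \<in> alt_hom scale 2" and \<delta>: "Vector_Spaces.linear scale scale \<delta>"
  shows "maurer_cartan (dc_scale scale) (dc_space scale) (dc_bracket scale) (\<lambda>n P. 0) (w, hom1 \<delta>)
    \<longleftrightarrow> lieder_pair scale (\<lambda>x y. w [x, y]) \<delta>"
proof -
  interpret vector_space scale by fact
  have half: "dc_scale scale (1/2) P = 0 \<longleftrightarrow> P = 0" for P
    by (cases P) (simp add: dc_scale_def zero_prod_def fun_eq_iff)
  have deg: "(w, hom1 \<delta>) \<in> dc_space scale 1"
    using w hom1_mem_alt_hom[OF \<delta>] by (simp add: dc_space_def numeral_2_eq_2)
  \<comment> \<open>Cancel the factor 2 in twice the derivation defect of
    \<open>\<delta>\<close>.\<close>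
  have deriv: "\<delta> (w [x, y]) + \<delta> (w [x, y])
      = w [\<delta> x, y] + w [x, \<delta> y] + w [\<delta> x, y] + w [x, \<delta> y] \<longleftrightarrow>
    \<delta> (w [x, y]) = w [\<delta> x, y] + w [x, \<delta> y]" for x y
    using double_eq_0_iff[OF vs, of "\<delta> (w [x, y]) - (w [\<delta> x, y] + w [x, \<delta> y])"]
    by (simp add: algebra_simps)
  have "maurer_cartan (dc_scale scale) (dc_space scale) (dc_bracket scale) (\<lambda>n P. 0) (w, hom1 \<delta>)
    \<longleftrightarrow> (\<forall>x y z. w [x, w [y, z]] + w [y, w [z, x]] + w [z, w [x, y]] = 0) \<and>
      (\<forall>x y. \<delta> (w [x, y]) = w [\<delta> x, y] + w [x, \<delta> y])"
    by (simp only: maurer_cartan_def deg add_0_left half dc_bracket_1_1_eq_0_iff[OF w w]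
        double_eq_0_iff[OF vs] deriv simp_thms)
  \<comment> \<open>Bilinearity and alternation come from membership in
    \<open>alt_hom scale 2\<close>; only the Jacobi identity and the Leibniz rule remain as
    conditions.\<close>
  also have "\<dots> \<longleftrightarrow> lieder_pair scale (\<lambda>x y. w [x, y]) \<delta>"
    using vs \<delta> alt_hom_2_bilinear[OF w] alt_hom_2_alternating[OF w]
    by (simp add: lieder_pair_def lie_algebra_def lie_algebra_axioms_def lieder_pair_axioms_def)
  finally show ?thesis .
qed

theorem theorem6p1:
  fixes scale :: "'k::field_char_0 \<Rightarrow> 'v::ab_group_add \<Rightarrow> 'v"
    and w1 w2 :: "'v list \<Rightarrow> 'v"
    and \<delta>1 \<delta>2 :: "'v \<Rightarrow> 'v"
  assumes "vector_space scale"
    and "w1 \<in> alt_hom scale 2" and "w2 \<in> alt_hom scale 2"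
    and "Vector_Spaces.linear scale scale \<delta>1" and "Vector_Spaces.linear scale scale \<delta>2"
  shows "compatible_lieder_pair scale (\<lambda>x y. w1 [x, y]) (\<lambda>x y. w2 [x, y]) \<delta>1 \<delta>2 \<longleftrightarrow>
    bidifferential_maurer_cartan (dc_scale scale) (dc_space scale) (dc_bracket scale)
      (\<lambda>n P. 0) (\<lambda>n P. 0) ((w1, hom1 \<delta>1), (w2, hom1 \<delta>2))"
  using assms
  \<comment> \<open>The self-brackets give the two LieDer pairs. The mixed bracket, with
    \<open>f = w1\<close> and \<open>g = w2\<close>, gives the two compatibility conditions, one per
    component.\<close>
  by (simp add: bidifferential_maurer_cartan_def maurer_cartan_iff_lieder_pair
      vector_space.dc_bracket_1_1_eq_0_iff[simplified] compatible_lieder_pair_def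
      compatible_lieder_pair_axioms_def)

end
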